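(* For $k\in\mathbb{N}$, let $SP(k)$ denote the minimum of $\max\{|A+A|,|AA|\}$ over all sets $A\subseteq\mathbb{N}$ with $|A|=k$. Then $$SP(k)=\begin{cases}3k-3, & 2\le k\le 7,\\ 3k-2, & k=8,9.\end{cases}$$
   Context: For $A\subseteq\mathbb{R}$, $A+A=\{a+b: a,b\in A\}$ and $AA=\{ab: a,b\in A\}$. $\mathbb{N}$ denotes the positive integers, and $|X|$ is the number of elements of a finite set $X$. *)

theory Defs
  imports Main "HOL-Library.Set_Algebras"
begin

text \<open>
  The operations \<^term>\<open>A + A\<close> and \<^term>\<open>A * A\<close> on sets are the elementwise sumset and product set.
  The condition \<^term>\<open>0 \<notin> A\<close> restricts to positive integers.
\<close>

definition SP :: "nat \<Rightarrow> nat" where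
  "SP k = (LEAST m. \<exists>A :: nat set. 0 \<notin> A \<and> finite A \<and> card A = k \<and>
                      m = max (card (A + A)) (card (A * A)))"

end

theory Submission
  imports Defs Complex_Main "HOL-Computational_Algebra.Primes"
begin

text \<open>
  For a prime \<open>p\<close>, the map \<open>n \<mapsto> (ln n, v\<^sub>p(n))\<close> carries products of positive integers to sums of points
  of the plane. By Freiman's lemma a planar set of \<open>k\<close> points that is not on a line has at least
  \<open>3k - 3\<close> sums, and a set of at least seven points with only \<open>3k - 3\<close> sums lies on two parallel lines.

  If \<open>|AA| \<le> 3k - 4\<close>, then for some \<open>p\<close> the valuation \<open>v\<^sub>p\<close> is strictly monotone on \<open>A\<close>. A sum whose smallest
  valuation is attained by just one summand has that valuation, so peeling off the element of lowest valuation
  shows that all \<open>k(k+1)/2\<close> sums are distinct, and \<open>|A + A| \<ge> 3k - 3\<close>.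

  If \<open>|AA| \<le> 3k - 3\<close> and \<open>k\<close> is 8 or 9, then for some \<open>p\<close> the points lie on two parallel lines of nonzero slope,
  so each valuation is attained at most twice. Peeling off a layer of one element costs \<open>k - 1\<close> sums and
  a layer of two elements costs \<open>k\<close> sums (even \<open>k + 1\<close> if \<open>k \<ge> 8\<close>), which adds up to more than \<open>3k - 3\<close>.
\<close>

section \<open>Sumsets of planar sets\<close>

lemma card_add_le_card:
  assumes "finite S" "X \<subseteq> S" "Y \<subseteq> S" "X \<inter> Y = {}"
  shows "card X + card Y \<le> card S"
  using assms card_Un_disjoint[of X Y] card_mono[of S "X \<union> Y"] finite_subset[of _ S] by auto

lemma ex_max:
  fixes f :: "'a \<Rightarrow> real"
  assumes "finite X" "X \<noteq> {}"
  obtains x where "x \<in> X" "\<And>z. z \<in> X \<Longrightarrow> f z \<le> f x"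
proof -
  have "Max (f ` X) \<in> f ` X" using assms by (intro Max_in) auto
  then obtain x where "x \<in> X" "Max (f ` X) = f x" by auto
  then show ?thesis using that[of x] assms(1) by (metis Max_ge finite_imageI imageI)
qed

text \<open>Induction on \<open>X\<close>: the sum of the \<open>f\<close>-largest \<open>x\<close>
  in \<open>X\<close> and an \<open>f\<close>-largest \<open>y\<close> in \<open>Y\<close> is
  missing from \<open>(X - {x}) + Y\<close>. The map \<open>f\<close> will be \<open>Re\<close> in
  the plane and \<open>real\<close> on integers.\<close>

lemma card_sumset_ge:
  fixes X Y :: "'a::cancel_comm_monoid_add set" and f :: "'a \<Rightarrow> real"
  assumes f: "\<And>x y. f (x + y) = f x + f y" and inj: "inj_on f X"
    and "finite X" "finite Y" "X \<noteq> {}" "Y \<noteq> {}"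
  shows "card X + card Y \<le> card (X + Y) + 1"
  using \<open>finite X\<close> \<open>X \<noteq> {}\<close> inj
proof (induction X rule: finite_psubset_induct)
  case (psubset X)
  obtain x where x: "x \<in> X" "\<And>z. z \<in> X \<Longrightarrow> f z \<le> f x"
    using ex_max[OF psubset.hyps(1) psubset.prems(1)] by blast
  obtain y where y: "y \<in> Y" "\<And>z. z \<in> Y \<Longrightarrow> f z \<le> f y"
    using ex_max[OF \<open>finite Y\<close> \<open>Y \<noteq> {}\<close>] by blast
  show ?case
  proof (cases "X = {x}")
    case True
    have "{x} + Y = (+) x ` Y" by (auto simp: set_plus_def)
    moreover have "card ((+) x ` Y) = card Y" by (intro card_image) simp
    ultimately show ?thesis using True by simp
  next
    case False
    let ?X = "X - {x}"
    have IH: "card ?X + card Y \<le> card (?X + Y) + 1"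
      using psubset.IH[of ?X] False x(1) psubset.prems by (auto simp: inj_on_diff)
    have "x + y \<notin> ?X + Y"
    proof
      assume "x + y \<in> ?X + Y"
      then obtain a b where ab: "a \<in> ?X" "b \<in> Y" "x + y = a + b"
        by (rule set_plus_elim) auto
      have "f a < f x" using ab(1) x psubset.prems(2) by (force simp: order_le_less dest: inj_onD)
      moreover have "f x + f y = f a + f b" using ab(3) f by metis
      ultimately show False using y(2)[OF ab(2)] by linarith
    qed
    then have "card (?X + Y) + card {x + y} \<le> card (X + Y)"
      using set_plus_mono2[of ?X X Y Y] x(1) y(1) psubset.hyps \<open>finite Y\<close>
      by (intro card_add_le_card finite_set_plus) auto
    moreover have "card X = Suc (card ?X)"
      using x(1) psubset.hyps by (metis card.remove)
    ultimately show ?thesis using IH by simp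
  qed
qed

text \<open>Lines are described by a slope, so vertical ones are excluded; all sets below have injective real part.\<close>

definition level :: "real \<Rightarrow> complex \<Rightarrow> real" where
  "level \<beta> z = Im z - \<beta> * Re z"

definition collinear :: "complex set \<Rightarrow> bool" where
  "collinear B \<longleftrightarrow> (\<exists>\<beta> c. \<forall>z\<in>B. level \<beta> z = c)"

definition two_lines :: "complex set \<Rightarrow> bool" where
  "two_lines B \<longleftrightarrow> (\<exists>\<beta> c d. \<forall>z\<in>B. level \<beta> z = c \<or> level \<beta> z = d)"

text \<open>A triangle of side 2 in the lattice spanned by \<open>u - a\<close> and \<open>w - a\<close>: six points, not on two parallel
  lines, that nevertheless have only \<open>15 = 3 \<cdot> 6 - 3\<close> sums.\<close>

definition triangle :: "complex set \<Rightarrow> bool" where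
  "triangle B \<longleftrightarrow> (\<exists>a u w. B = {a, u, w, 2 * u - a, u + w - a, 2 * w - a})"

lemma level_add [simp]: "level \<beta> (x + y) = level \<beta> x + level \<beta> y"
  by (simp add: level_def algebra_simps)

lemma level_diff [simp]: "level \<beta> (x - y) = level \<beta> x - level \<beta> y"
  by (simp add: level_def algebra_simps)

lemma level_double [simp]: "level \<beta> (2 * x) = 2 * level \<beta> x"
  by (simp add: level_def algebra_simps)

lemma ex_level_eq: "Re u \<noteq> Re w \<Longrightarrow> \<exists>\<beta>. level \<beta> u = level \<beta> w"
  by (rule exI[of _ "(Im u - Im w) / (Re u - Re w)"]) (simp add: level_def field_simps)

lemma collinear_empty: "collinear {}"
  by (simp add: collinear_def)

lemma collinear_singleton: "collinear {a}"
  by (auto simp: collinear_def)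

lemma collinear_pair:
  assumes "inj_on Re {a, b}" shows "collinear {a, b}"
proof (cases "a = b")
  case True then show ?thesis by (simp add: collinear_singleton)
next
  case False
  then have "Re a \<noteq> Re b" using assms by auto
  then show ?thesis using ex_level_eq[of b a] by (auto simp: collinear_def)
qed

lemma card_ge_3_if_not_collinear:
  assumes "finite B" "inj_on Re B" "\<not> collinear B"
  shows "3 \<le> card B"
proof (rule ccontr)
  assume "\<not> 3 \<le> card B"
  then consider "card B = 0" | "card B = 1" | "card B = 2" by linarith
  then show False
  proof cases
    case 1 then show ?thesis using assms collinear_empty by simp
  next
    case 2 then show ?thesis using assms collinear_singleton by (metis card_1_singletonE)
  next
    case 3 then show ?thesis using assms collinear_pair by (metis card_2_iff)
  qed
qed

lemma ex_max_on:
  fixes f :: "'a \<Rightarrow> real"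
  assumes "finite B" "B \<noteq> {}" "inj_on f B"
  obtains a where "a \<in> B" "\<And>z. z \<in> B - {a} \<Longrightarrow> f z < f a"
proof -
  obtain x where "x \<in> B" "\<And>z. z \<in> B \<Longrightarrow> f z \<le> f x"
    using ex_max[OF assms(1,2)] by blast
  then show ?thesis using assms(3) that[of x] by (force simp: order_le_less dest: inj_onD)
qed

text \<open>If deleting the rightmost point \<open>a\<close> loses only the two unavoidable sums, then every other
  point \<open>b\<close> satisfies \<open>a + b = x + y\<close> with \<open>x\<close>, \<open>y\<close> strictly between \<open>b\<close> and \<open>a\<close>; going from right
  to left, this puts all points on the line through the two rightmost ones.\<close>

lemma three_new_sums:
  assumes "finite B" "inj_on Re B" "\<not> collinear B"
  obtains a N where "a \<in> B" "N \<subseteq> B + B" "N \<inter> ((B - {a}) + (B - {a})) = {}" "card N = 3"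
    "\<And>z. z \<in> B - {a} \<Longrightarrow> Re z < Re a"
proof -
  have "3 \<le> card B" using card_ge_3_if_not_collinear assms by blast
  then have ne: "B \<noteq> {}" by auto
  obtain a where a: "a \<in> B" "\<And>z. z \<in> B - {a} \<Longrightarrow> Re z < Re a"
    using ex_max_on[OF assms(1) ne assms(2)] by blast
  have "card (B - {a}) \<ge> 2" using a(1) assms(1) \<open>3 \<le> card B\<close> by simp
  then have ne': "B - {a} \<noteq> {}" by (metis card.empty not_numeral_le_zero)
  have inj': "inj_on Re (B - {a})" using assms(2) by (simp add: inj_on_diff)
  obtain e where e: "e \<in> B - {a}" "\<And>z. z \<in> B - {a} - {e} \<Longrightarrow> Re z < Re e"
    using ex_max_on[OF _ ne' inj'] assms(1) by blast
  obtain \<beta> where \<beta>: "level \<beta> e = level \<beta> a" using ex_level_eq[of e a] a(2)[OF e(1)] by auto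
  \<comment> \<open>The third new sum comes from \<open>b\<close>, the rightmost point off the line
    through \<open>a\<close> and \<open>e\<close>.\<close>
  define Q where "Q = {z \<in> B. level \<beta> z \<noteq> level \<beta> a}"
  have "Q \<noteq> {}" using assms(3) unfolding Q_def collinear_def by blast
  moreover have "finite Q" "inj_on Re Q" using assms unfolding Q_def by (auto intro: inj_on_subset)
  ultimately obtain b where b: "b \<in> Q" "\<And>z. z \<in> Q - {b} \<Longrightarrow> Re z < Re b"
    using ex_max_on by blast
  have bB: "b \<in> B" "b \<noteq> a" "b \<noteq> e" using b(1) \<beta> by (auto simp: Q_def)
  have le: "Re z \<le> Re e" if "z \<in> B - {a}" for z using e(2)[of z] that by (cases "z = e") auto
  let ?S = "(B - {a}) + (B - {a})"
  have n1: "x + y \<noteq> a + a" "x + y \<noteq> a + e" if "x \<in> B - {a}" "y \<in> B - {a}" for x y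
  proof -
    have "Re x + Re y < Re a + Re e" using le[OF that(1)] le[OF that(2)] a(2)[OF e(1)] by linarith
    then show "x + y \<noteq> a + a" "x + y \<noteq> a + e" using a(2)[OF e(1)]
      by (auto simp: complex_eq_iff)
  qed
  have n2: "x + y \<noteq> a + b" if "x \<in> B - {a}" "y \<in> B - {a}" for x y
  proof
    assume eq: "x + y = a + b"
    \<comment> \<open>As \<open>x\<close> and \<open>y\<close> lie left of \<open>a\<close>, both
      lie right of \<open>b\<close>, hence on the line through \<open>a\<close> and
      \<open>e\<close>; then \<open>b\<close> would lie there too.\<close>
    then have "Re x + Re y = Re a + Re b" by (metis plus_complex.simps(1))
    then have "Re x > Re b" "Re y > Re b" using a(2)[OF that(1)] a(2)[OF that(2)] by linarith+
    then have "x \<notin> Q" "y \<notin> Q" using b(2)[of x] b(2)[of y] by fastforce+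
    then have "level \<beta> x = level \<beta> a" "level \<beta> y = level \<beta> a" using that by (auto simp: Q_def)
    then have "level \<beta> b = level \<beta> a" using arg_cong[OF eq, of "level \<beta>"] by simp
    then show False using b(1) by (simp add: Q_def)
  qed
  show ?thesis
  proof (rule that[of a "{a + a, a + e, a + b}"])
    show "{a + a, a + e, a + b} \<inter> ?S = {}" using n1 n2 by (fastforce elim!: set_plus_elim)
    show "card {a + a, a + e, a + b} = 3" using bB e(1) by auto
    show "{a + a, a + e, a + b} \<subseteq> B + B" using a(1) e(1) bB(1)
      by (intro insert_subsetI set_plus_intro) auto
  qed (use a in auto)
qed

section \<open>Sumsets of sets on two parallel lines and Freiman's lemma\<close>

text \<open>The three sumsets lie on the distinct levels \<open>2 * c\<close>, \<open>c + d\<close>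
  and \<open>2 * d\<close>.\<close>

lemma card_sumset_levels:
  assumes "finite L" "finite M"
    and "\<And>z. z \<in> L \<Longrightarrow> level \<beta> z = c" "\<And>z. z \<in> M \<Longrightarrow> level \<beta> z = d" "c \<noteq> d"
  shows "card (L + L) + card (L + M) + card (M + M) \<le> card ((L \<union> M) + (L \<union> M))"
proof -
  let ?S = "(L \<union> M) + (L \<union> M)"
  have fin: "finite ?S" using assms by (intro finite_set_plus) auto
  have lv: "level \<beta> z = 2 * c" if "z \<in> L + L" for z
    using that assms(3) by (auto elim!: set_plus_elim)
  have lv2: "level \<beta> z = c + d" if "z \<in> L + M" for z
    using that assms(3,4) by (auto elim!: set_plus_elim)
  have lv3: "level \<beta> z = 2 * d" if "z \<in> M + M" for z
    using that assms(4) by (auto elim!: set_plus_elim)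
  have "card (L + L) + card (L + M) \<le> card (L + (L \<union> M))"
  proof (intro card_add_le_card finite_set_plus set_plus_mono2)
    show "(L + L) \<inter> (L + M) = {}" using lv lv2 assms(5) by fastforce
  qed (use assms(1,2) in auto)
  moreover have "card (L + (L \<union> M)) + card (M + M) \<le> card ?S"
  proof (intro card_add_le_card fin set_plus_mono2)
    show "(L + (L \<union> M)) \<inter> (M + M) = {}" using lv lv2 lv3 assms(5) by (fastforce simp: set_plus_Un)
  qed auto
  ultimately show ?thesis by linarith
qed

text \<open>Only \<open>L + M\<close> and \<open>M + M\<close> are estimated. \<open>L + L\<close>
  stays, since its bound depends on the use: \<open>2 * card L - 1\<close> in general, but
  \<open>3 * card L - 3\<close> if another prime shows \<open>L\<close> to be spread out.\<close>

lemma card_sumset_two_lines: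
  assumes "finite L" "finite M" "L \<noteq> {}" "M \<noteq> {}" "inj_on Re L" "inj_on Re M"
    and "\<And>z. z \<in> L \<Longrightarrow> level \<beta> z = c" "\<And>z. z \<in> M \<Longrightarrow> level \<beta> z = d" "c \<noteq> d"
  shows "card (L + L) + card L + 3 * card M \<le> card ((L \<union> M) + (L \<union> M)) + 2"
proof -
  have "card L + card M \<le> card (L + M) + 1" "card M + card M \<le> card (M + M) + 1"
    using assms by (intro card_sumset_ge[of Re]; simp)+
  then show ?thesis using card_sumset_levels[OF assms(1,2,7-9)] by linarith
qed

text \<open>Freiman's lemma in the plane, by deleting the rightmost point \<open>a\<close>. Three
  sums are lost if the rest is not collinear; if it is, the two-line bound with
  \<open>M = {a}\<close> already gives \<open>3 * (card B - 1)\<close> sums.\<close>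

lemma card_sumset_if_not_collinear:
  assumes "finite B" "inj_on Re B" "\<not> collinear B"
  shows "3 * card B \<le> card (B + B) + 3"
  using assms
proof (induction B rule: finite_psubset_induct)
  case (psubset B)
  obtain a N where aN: "a \<in> B" "N \<subseteq> B + B" "N \<inter> ((B - {a}) + (B - {a})) = {}" "card N = 3"
    using three_new_sums psubset.hyps psubset.prems by metis
  let ?C = "B - {a}"
  have card: "card B = Suc (card ?C)" using aN(1) psubset.hyps by (metis card.remove)
  have inj: "inj_on Re ?C" using psubset.prems by (simp add: inj_on_diff)
  show ?case
  proof (cases "collinear ?C")
    case False
    have "card (?C + ?C) + card N \<le> card (B + B)"
      using aN psubset.hyps by (intro card_add_le_card finite_set_plus set_plus_mono2) auto
    moreover have "3 * card ?C \<le> card (?C + ?C) + 3"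
      using psubset.IH[of ?C] inj False aN(1) by auto
    ultimately show ?thesis using card aN(4) by simp
  next
    case True
    then obtain \<beta> c where c: "\<And>z. z \<in> ?C \<Longrightarrow> level \<beta> z = c" unfolding collinear_def by auto
    have "level \<beta> a \<noteq> c" using psubset.prems(2) c unfolding collinear_def by blast
    moreover have ne: "?C \<noteq> {}" using card_ge_3_if_not_collinear psubset.hyps psubset.prems card
      by fastforce
    ultimately have "card (?C + ?C) + card ?C + 3 * card {a} \<le> card ((?C \<union> {a}) + (?C \<union> {a})) + 2"
      using psubset.hyps inj c by (intro card_sumset_two_lines[of _ _ \<beta> c "level \<beta> a"]) auto
    moreover have "card ?C + card ?C \<le> card (?C + ?C) + 1"
      using psubset.hyps inj ne by (intro card_sumset_ge[of Re]) auto
    moreover have "?C \<union> {a} = B" using aN(1) by auto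
    ultimately show ?thesis using card by simp
  qed
qed

section \<open>Planar sets with the smallest possible sumset\<close>

text \<open>If \<open>g b < m\<close>, the sums of \<open>b\<close> with \<open>b\<close>,
  \<open>x\<close>, \<open>y\<close>, \<open>z\<close> have \<open>g\<close>-value below
  \<open>2 * m\<close>: four new sums where three are allowed. The points \<open>x\<close>,
  \<open>y\<close>, \<open>z\<close> will be those on one side of a triangle.\<close>

lemma no_new_point_beyond_triangle_side:
  fixes g :: "complex \<Rightarrow> real"
  assumes add: "\<And>x y. g (x + y) = g x + g y"
    and xyz: "x \<in> C" "y \<in> C" "z \<in> C" "x \<noteq> y" "y \<noteq> z" "x \<noteq> z"
      "g x = m" "g y = m" "g z = m"
    and ge: "\<And>v. v \<in> C \<Longrightarrow> m \<le> g v"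
    and new: "\<And>N. N \<subseteq> insert b C + insert b C \<Longrightarrow> N \<inter> (C + C) = {} \<Longrightarrow> card N \<le> 3"
  shows "m \<le> g b"
proof (rule ccontr)
  assume less: "\<not> m \<le> g b"
  let ?N = "(+) b ` {b, x, y, z}"
  have "?N \<inter> (C + C) = {}"
  proof (rule ccontr)
    assume "?N \<inter> (C + C) \<noteq> {}"
    then obtain s where "s \<in> ?N" "s \<in> C + C" by auto
    moreover from \<open>s \<in> C + C\<close> obtain v w where "v \<in> C" "w \<in> C" "s = v + w"
      by (rule set_plus_elim) auto
    ultimately have "g v + g w \<in> g ` ?N" using add by (metis imageI)
    then have "g v + g w < 2 * m" using less xyz add[of b b] by (auto simp: add)
    then show False using ge[OF \<open>v \<in> C\<close>] ge[OF \<open>w \<in> C\<close>] by linarith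
  qed
  moreover have "?N \<subseteq> insert b C + insert b C"
    using xyz(1-3) by (intro image_subsetI set_plus_intro) auto
  ultimately have "card ?N \<le> 3" using new by blast
  moreover have "b \<noteq> x" "b \<noteq> y" "b \<noteq> z" using less xyz by auto
  then have "card ?N = 4" using xyz(4-6) by (subst card_image) auto
  ultimately show False by simp
qed

text \<open>Each side of the triangle keeps \<open>b\<close> on its inner side, and a coincidence of
  sums makes \<open>b\<close> a lattice point. The only lattice points in the triangle are the six
  points of \<open>C\<close>.\<close>

lemma triangle_not_extendable:
  assumes C: "C = {a, u, w, 2 * u - a, u + w - a, 2 * w - a}"
    and "\<not> collinear C" "inj_on Re C" "b \<notin> C"
    and new: "\<And>N. N \<subseteq> insert b C + insert b C \<Longrightarrow> N \<inter> (C + C) = {} \<Longrightarrow> card N \<le> 3"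
  shows False
proof -
  \<comment> \<open>\<open>D\<close> is the determinant of \<open>u - a\<close> and
    \<open>w - a\<close>; by Cramer's rule \<open>s\<close> and \<open>t\<close> are the coordinates
    in this basis.\<close>
  define D where "D = Re (u - a) * Im (w - a) - Im (u - a) * Re (w - a)"
  define s where "s z = (Re z * Im (w - a) - Im z * Re (w - a)) / D" for z
  define t where "t z = (Re (u - a) * Im z - Im (u - a) * Re z) / D" for z
  have D: "D \<noteq> 0"
  proof
    assume "D = 0"
    show False
    proof (cases "Re u = Re a")
      case True
      then have "u = a" using assms(3) C by (auto dest: inj_onD)
      have "Re w \<noteq> Re a"
      proof
        assume "Re w = Re a"
        then have "w = a" using assms(3) C by (auto dest: inj_onD)
        then show False using assms(2) C \<open>u = a\<close> collinear_singleton[of a] by simp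
      qed
      then obtain \<beta> where "level \<beta> w = level \<beta> a" using ex_level_eq by blast
      then have "\<forall>z\<in>C. level \<beta> z = level \<beta> a" using C \<open>u = a\<close> by auto
      then show False using assms(2) unfolding collinear_def by blast
    next
      case False
      define \<beta> where "\<beta> = Im (u - a) / Re (u - a)"
      have "level \<beta> u = level \<beta> a" "level \<beta> w = level \<beta> a"
        using False \<open>D = 0\<close> by (auto simp: \<beta>_def D_def level_def field_simps)
      then have "\<forall>z\<in>C. level \<beta> z = level \<beta> a" using C by auto
      then show False using assms(2) unfolding collinear_def by blast
    qed
  qed
  have sadd: "s (x + y) = s x + s y" and tadd: "t (x + y) = t x + t y" for x y
    by (simp_all add: s_def t_def field_simps add_divide_distrib[symmetric])
  have sdiff: "s (x - y) = s x - s y" and tdiff: "t (x - y) = t x - t y" for x y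
    by (simp_all add: s_def t_def field_simps diff_divide_distrib[symmetric])
  have sdouble: "s (2 * x) = 2 * s x" and tdouble: "t (2 * x) = 2 * t x" for x
    using sadd[of x x] tadd[of x x] by simp_all
  have u: "s (u - a) = 1" "t (u - a) = 0" and w: "s (w - a) = 0" "t (w - a) = 1"
    using D by (simp_all add: s_def t_def D_def mult.commute)
  have su: "s u = s a + 1" "t u = t a" "s w = s a" "t w = t a + 1"
    using u w by (simp_all add: sdiff tdiff)
  have eqI: "x = y" if "s x = s y" "t x = t y" for x y
  proof -
    have e1: "Re z * D = D * s z * Re (u - a) + D * t z * Re (w - a)" for z
      using D by (simp add: s_def t_def) (simp add: D_def algebra_simps)
    have e2: "Im z * D = D * s z * Im (u - a) + D * t z * Im (w - a)" for z
      using D by (simp add: s_def t_def) (simp add: D_def algebra_simps)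
    have "Re x * D = Re y * D" "Im x * D = Im y * D" using e1[of x] e1[of y] e2[of x] e2[of y] that by auto
    then show ?thesis using D by (simp add: complex_eq_iff)
  qed
  have coord: "s z - s a \<in> {0, 1, 2} \<and> t z - t a \<in> {0, 1, 2} \<and> s z + t z \<le> s a + t a + 2" if "z \<in> C" for z
    using that su unfolding C by (auto simp: sadd tadd sdiff tdiff sdouble tdouble)
  have ne: "u \<noteq> a" "w \<noteq> a" "u \<noteq> w" using su by auto
  have neqI: "x \<noteq> y" if "s x \<noteq> s y \<or> t x \<noteq> t y" for x y using that by auto
  have pts: "s (2 * u - a) = s a + 2" "t (2 * u - a) = t a" "s (u + w - a) = s a + 1"
    "t (u + w - a) = t a + 1" "s (2 * w - a) = s a" "t (2 * w - a) = t a + 2"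
    by (simp_all add: su sadd sdiff tadd tdiff sdouble tdouble)
  have "s a \<le> s b"
  proof (rule no_new_point_beyond_triangle_side[where x = "a" and y = "w" and z = "2 * w - a" and C = C and g = "s"])
    show "a \<in> C" "w \<in> C" "2 * w - a \<in> C" by (simp_all add: C)
    show "a \<noteq> w" "w \<noteq> 2 * w - a" "a \<noteq> 2 * w - a" by (rule neqI; simp add: pts su)+
    show "s a \<le> s v" if "v \<in> C" for v using coord[OF that] by auto
  qed (use new in \<open>simp_all add: sadd tadd pts su\<close>)
  moreover have "t a \<le> t b"
  proof (rule no_new_point_beyond_triangle_side[where x = "a" and y = "u" and z = "2 * u - a" and C = C and g = "t"])
    show "a \<in> C" "u \<in> C" "2 * u - a \<in> C" by (simp_all add: C)
    show "a \<noteq> u" "u \<noteq> 2 * u - a" "a \<noteq> 2 * u - a" by (rule neqI; simp add: pts su)+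
    show "t a \<le> t v" if "v \<in> C" for v using coord[OF that] by auto
  qed (use new in \<open>simp_all add: sadd tadd pts su\<close>)
  \<comment> \<open>On the third side \<open>s + t\<close> is largest; the sign turns this into a
    minimum.\<close>
  moreover have "- (s a + t a + 2) \<le> - (s b + t b)"
  proof (rule no_new_point_beyond_triangle_side[where x = "2 * u - a" and y = "2 * w - a" and z = "u + w - a" and C = C and g = "\<lambda>z. - (s z + t z)"])
    show "2 * u - a \<in> C" "2 * w - a \<in> C" "u + w - a \<in> C" by (simp_all add: C)
    show "2 * u - a \<noteq> 2 * w - a" "2 * w - a \<noteq> u + w - a" "2 * u - a \<noteq> u + w - a" by (rule neqI; simp add: pts su)+
    show "- (s a + t a + 2) \<le> (\<lambda>z. - (s z + t z)) v" if "v \<in> C" for v using coord[OF that] by auto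
  qed (use new in \<open>simp_all add: sadd tadd pts su\<close>)
  ultimately have bounds: "s a \<le> s b" "t a \<le> t b" "s b + t b \<le> s a + t a + 2" by linarith+
  \<comment> \<open>Four sums of \<open>b\<close> with points of \<open>C\<close> cannot all be new.
    An old one expresses \<open>b\<close> through points of \<open>C\<close>, so its coordinates
    relative to \<open>a\<close> are integers.\<close>
  obtain z x y where "z \<in> C" "x \<in> C" "y \<in> C" "b + z = x + y"
  proof -
    let ?N = "(+) b ` {a, u, w, 2 * u - a}"
    have "?N \<subseteq> insert b C + insert b C"
      using C by (intro image_subsetI set_plus_intro) auto
    moreover have "2 * u - a \<noteq> a" "2 * u - a \<noteq> u" "2 * u - a \<noteq> w" by (rule neqI; simp add: pts su)+
    then have "card ?N = 4" using ne by (subst card_image) auto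
    ultimately have "?N \<inter> (C + C) \<noteq> {}" using new[of ?N] by linarith
    then have "\<exists>z\<in>C. b + z \<in> C + C" using C by blast
    then show ?thesis using that by (auto elim!: set_plus_elim)
  qed
  then have "s b - s a = (s x - s a) + (s y - s a) - (s z - s a)"
    "t b - t a = (t x - t a) + (t y - t a) - (t z - t a)"
    using sadd[of b z] sadd[of x y] tadd[of b z] tadd[of x y] by simp_all
  moreover have int: "s v - s a \<in> \<int>" "t v - t a \<in> \<int>" if "v \<in> C" for v
    using coord[OF that] by auto
  ultimately have "s b - s a \<in> \<int>" "t b - t a \<in> \<int>"
    using \<open>z \<in> C\<close> \<open>x \<in> C\<close> \<open>y \<in> C\<close> by (metis Ints_add Ints_diff)+
  then obtain i j :: int where "s b - s a = i" "t b - t a = j" by (auto elim!: Ints_cases)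
  then have b: "s b = s a + i" "t b = t a + j" by simp_all
  have "0 \<le> i" "0 \<le> j" "i + j \<le> 2" using bounds unfolding b by linarith+
  then consider "i = 0" "j = 0" | "i = 1" "j = 0" | "i = 0" "j = 1" | "i = 2" "j = 0"
    | "i = 1" "j = 1" | "i = 0" "j = 2" by linarith
  then have "b = a \<or> b = u \<or> b = w \<or> b = 2 * u - a \<or> b = u + w - a \<or> b = 2 * w - a"
    using eqI[of b a] eqI[of b u] eqI[of b w] eqI[of b "2 * u - a"] eqI[of b "u + w - a"]
      eqI[of b "2 * w - a"] by cases (simp_all add: pts su b)
  then show False using assms(4) C by auto
qed

section \<open>Adding a point to a set on two parallel lines\<close>

text \<open>The point \<open>b\<close> lies on a third, equally spaced line next to that of
  \<open>M\<close>. Hence \<open>b + b\<close> and all of \<open>b + M\<close> are new, and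
  \<open>b + x\<close> with \<open>x\<close> in \<open>L\<close> is old only if it is in
  \<open>M + M\<close>; with at most three new sums, few shapes remain.\<close>

lemma third_line_case:
  assumes fin: "finite L" "finite M" and ne: "L \<noteq> {}" "M \<noteq> {}" and "3 \<le> card (L \<union> M)"
    and L: "\<And>z. z \<in> L \<Longrightarrow> level \<beta> z = c" and M: "\<And>z. z \<in> M \<Longrightarrow> level \<beta> z = d" and "c \<noteq> d"
    and b: "level \<beta> b = 2 * d - c" and inj: "inj_on Re (insert b (L \<union> M))"
    and small: "card ((L \<union> M) + (L \<union> M)) + 3 \<le> 3 * card (L \<union> M)"
    and new: "\<And>N. N \<subseteq> insert b (L \<union> M) + insert b (L \<union> M) \<Longrightarrow>
                N \<inter> ((L \<union> M) + (L \<union> M)) = {} \<Longrightarrow> card N \<le> 3"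
  shows "two_lines (insert b (L \<union> M)) \<or> triangle (insert b (L \<union> M))"
proof -
  define L' where "L' = {x \<in> L. b + x \<notin> M + M}"
  have lv: "level \<beta> z = 2 * c \<or> level \<beta> z = c + d \<or> z \<in> M + M \<and> level \<beta> z = 2 * d"
    if "z \<in> (L \<union> M) + (L \<union> M)" for z
    using that L M by (auto elim!: set_plus_elim)
  have "b \<notin> L" "b \<notin> M" "L \<inter> M = {}" using L M b \<open>c \<noteq> d\<close> by force+
  have card_le: "card M + card L' \<le> 2"
  proof -
    let ?N = "(+) b ` insert b (M \<union> L')"
    have "level \<beta> (b + b) \<noteq> 2 * c" "level \<beta> (b + b) \<noteq> c + d" "level \<beta> (b + b) \<noteq> 2 * d"
      using b \<open>c \<noteq> d\<close> by auto
    then have "b + b \<notin> (L \<union> M) + (L \<union> M)" using lv by blast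
    moreover have "b + z \<notin> (L \<union> M) + (L \<union> M)" if "z \<in> M" for z
    proof -
      have "level \<beta> (b + z) \<noteq> 2 * c" "level \<beta> (b + z) \<noteq> c + d" "level \<beta> (b + z) \<noteq> 2 * d"
        using b \<open>c \<noteq> d\<close> M[OF that] by auto
      then show ?thesis using lv by blast
    qed
    moreover have "b + z \<notin> (L \<union> M) + (L \<union> M)" if "z \<in> L'" for z
    proof -
      have "level \<beta> (b + z) \<noteq> 2 * c" "level \<beta> (b + z) \<noteq> c + d"
        using b \<open>c \<noteq> d\<close> L that by (auto simp: L'_def)
      then show ?thesis using lv[of "b + z"] that by (auto simp: L'_def)
    qed
    ultimately have "?N \<inter> ((L \<union> M) + (L \<union> M)) = {}" by blast
    moreover have "?N \<subseteq> insert b (L \<union> M) + insert b (L \<union> M)"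
      by (intro image_subsetI set_plus_intro) (auto simp: L'_def)
    ultimately have "card ?N \<le> 3" using new by blast
    moreover have "card ?N = card (insert b (M \<union> L'))" by (rule card_image) (auto simp: inj_on_def)
    moreover have "card (insert b (M \<union> L')) = Suc (card (M \<union> L'))"
      using fin \<open>b \<notin> L\<close> \<open>b \<notin> M\<close> by (auto simp: L'_def)
    moreover have "card (M \<union> L') = card M + card L'"
      using fin \<open>L \<inter> M = {}\<close> by (intro card_Un_disjoint) (auto simp: L'_def)
    ultimately show ?thesis by linarith
  qed
  have dir: "\<exists>\<beta>'. level \<beta>' b = level \<beta>' u" if "u \<in> M" for u
  proof -
    have "Re b \<noteq> Re u" using inj that \<open>b \<notin> M\<close> by (auto dest: inj_onD)
    then show ?thesis using ex_level_eq by blast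
  qed
  have "card M \<noteq> 0" using ne fin by simp
  then consider "card M = 1" | "card M = 2" "card L' = 0" using card_le by linarith
  then show ?thesis
  proof cases
    case 1
    then obtain u where u: "M = {u}" by (metis card_1_singletonE)
    then obtain \<beta>' where \<beta>': "level \<beta>' b = level \<beta>' u" using dir by auto
    have "card L' \<le> 1" using card_le 1 by simp
    then obtain y where y: "L' \<subseteq> {y}"
      by (metis One_nat_def card_1_singletonE card_eq_0_iff empty_subsetI fin(1) finite_subset L'_def
          le_SucE le_zero_eq mem_Collect_eq subsetI subset_refl)
    \<comment> \<open>A point of \<open>L\<close> outside \<open>L'\<close> is the reflection
      \<open>2 * u - b\<close>, on the line through \<open>b\<close> and \<open>u\<close>; the
      parallel through \<open>y\<close> covers \<open>L'\<close>.\<close>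
    have "level \<beta>' z = level \<beta>' b \<or> level \<beta>' z = level \<beta>' y" if "z \<in> insert b (L \<union> M)" for z
    proof (cases "z \<in> L \<and> z \<notin> L'")
      case True
      then have "b + z = u + u" unfolding L'_def u by (auto elim!: set_plus_elim)
      from arg_cong[OF this, of "level \<beta>'"] show ?thesis using \<beta>' by simp
    next
      case False
      then show ?thesis using that y \<beta>' u by auto
    qed
    then show ?thesis unfolding two_lines_def by blast
  next
    case 2
    then obtain u w where uw: "M = {u, w}" "u \<noteq> w" by (metis card_2_iff)
    have "L' = {}" using 2 fin by (simp add: L'_def)
    have Lsub: "L \<subseteq> {2 * u - b, u + w - b, 2 * w - b}"
    proof
      fix z assume "z \<in> L"
      then have "b + z \<in> M + M" using \<open>L' = {}\<close> by (auto simp: L'_def)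
      then have "b + z = 2 * u \<or> b + z = u + w \<or> b + z = 2 * w"
        unfolding uw by (auto elim!: set_plus_elim)
      then show "z \<in> {2 * u - b, u + w - b, 2 * w - b}" by (auto simp: algebra_simps)
    qed
    \<comment> \<open>If one corner of the triangle is missing, the line through \<open>b\<close>
      and \<open>x\<close> and its parallel through \<open>y\<close> contain all points.\<close>
    have no_corner: "two_lines (insert b (L \<union> M))"
      if xy: "M = {x, y}" "L \<subseteq> {2 * x - b, x + y - b}" for x y
    proof -
      obtain \<beta>' where "level \<beta>' b = level \<beta>' x" using dir[of x] xy(1) by blast
      then have "level \<beta>' z = level \<beta>' x \<or> level \<beta>' z = level \<beta>' y" if "z \<in> insert b (L \<union> M)" for z
        using that xy by auto
      then show ?thesis unfolding two_lines_def by blast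
    qed
    consider "2 * w - b \<notin> L" | "2 * u - b \<notin> L" | "L = {2 * u - b, u + w - b, 2 * w - b}"
      | "L = {2 * u - b, 2 * w - b}" using Lsub by blast
    then show ?thesis
    proof cases
      case 1
      then have "L \<subseteq> {2 * u - b, u + w - b}" using Lsub by auto
      then show ?thesis using no_corner uw by blast
    next
      case 2
      then have "L \<subseteq> {2 * w - b, w + u - b}" using Lsub by (auto simp: add.commute)
      then show ?thesis using no_corner[of w u] uw by (simp add: insert_commute)
    next
      case 3
      then have "insert b (L \<union> M) = {b, u, w, 2 * u - b, u + w - b, 2 * w - b}" using uw by auto
      then show ?thesis unfolding triangle_def by blast
    next
      case 4
      \<comment> \<open>Both corners without the midpoint between them: four points with at least
        \<open>3 + 4 + 3 = 10\<close> sums, while \<open>small\<close> allows nine.\<close>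
      have "(2 * u - b) + u \<noteq> (2 * w - b) + w" "(2 * u - b) + w \<noteq> (2 * w - b) + u"
        "2 * u - b \<noteq> 2 * w - b" using uw(2) by (auto simp: algebra_simps)
      then have "card {(2 * u - b) + u, (2 * u - b) + w, (2 * w - b) + u, (2 * w - b) + w} = 4"
        using uw(2) by (simp add: card_insert_if)
      moreover have "L + M = {(2 * u - b) + u, (2 * u - b) + w, (2 * w - b) + u, (2 * w - b) + w}"
        unfolding 4 uw(1) by (auto simp: set_plus_def)
      ultimately have "card (L + M) = 4" by simp
      moreover have "card L = 2" using 4 uw(2) by auto
      moreover have "card L + card L \<le> card (L + L) + 1" "card M + card M \<le> card (M + M) + 1"
        using fin ne inj by (intro card_sumset_ge[of Re]; auto intro: inj_on_subset)+
      moreover have "card (L \<union> M) = card L + card M"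
        using fin \<open>L \<inter> M = {}\<close> by (rule card_Un_disjoint)
      ultimately show ?thesis
        using card_sumset_levels[of L M \<beta> c d] fin L M \<open>c \<noteq> d\<close> small \<open>card M = 2\<close> by simp
    qed
  qed
qed

text \<open>An old sum \<open>b + z\<close> puts \<open>b\<close> on level \<open>c\<close>,
  \<open>d\<close>, \<open>2 * d - c\<close> or \<open>2 * c - d\<close>. On any other level all
  \<open>card C + 1\<close> sums with \<open>b\<close> are new, and that is more than three.\<close>

lemma two_lines_extend:
  assumes "finite C" "inj_on Re (insert b C)" "\<not> collinear C" "two_lines C" "b + b \<notin> C + C"
    and small: "card (C + C) + 3 \<le> 3 * card C"
    and new: "\<And>N. N \<subseteq> insert b C + insert b C \<Longrightarrow> N \<inter> (C + C) = {} \<Longrightarrow> card N \<le> 3"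
  shows "two_lines (insert b C) \<or> triangle (insert b C)"
proof -
  obtain \<beta> c d where cd: "\<And>z. z \<in> C \<Longrightarrow> level \<beta> z = c \<or> level \<beta> z = d"
    using assms(4) unfolding two_lines_def by blast
  define L where "L = {z \<in> C. level \<beta> z = c}"
  define M where "M = {z \<in> C. level \<beta> z = d}"
  have C: "C = L \<union> M" "C = M \<union> L" using cd by (auto simp: L_def M_def)
  have "L \<noteq> {}" "M \<noteq> {}" "c \<noteq> d"
    using assms(3) cd unfolding collinear_def L_def M_def by blast+
  have fin: "finite L" "finite M" using assms(1) by (auto simp: L_def M_def)
  have card3: "3 \<le> card C"
    using card_ge_3_if_not_collinear[of C] assms(1-3) by simp
  consider "level \<beta> b = c \<or> level \<beta> b = d" | "level \<beta> b = 2 * d - c" | "level \<beta> b = 2 * c - d"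
    | "level \<beta> b \<noteq> c" "level \<beta> b \<noteq> d" "level \<beta> b \<noteq> 2 * d - c" "level \<beta> b \<noteq> 2 * c - d" by blast
  then show ?thesis
  proof cases
    case 1
    then have "two_lines (insert b C)"
      unfolding two_lines_def using cd by (intro exI[of _ \<beta>] exI[of _ c] exI[of _ d]) auto
    then show ?thesis ..
  next
    case 2
    show ?thesis unfolding C(1)
    proof (rule third_line_case[where L = L and M = M and \<beta> = \<beta> and c = c and d = d])
      show "card N \<le> 3" if "N \<subseteq> insert b (L \<union> M) + insert b (L \<union> M)"
        "N \<inter> ((L \<union> M) + (L \<union> M)) = {}" for N
        using new that unfolding C(1) by blast
      show "inj_on Re (insert b (L \<union> M))" using assms(2) unfolding C(1) .
      show "card ((L \<union> M) + (L \<union> M)) + 3 \<le> 3 * card (L \<union> M)" using small unfolding C(1) .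
      show "3 \<le> card (L \<union> M)" using card3 unfolding C(1) .
      show "level \<beta> z = c" if "z \<in> L" for z using that by (simp add: L_def)
      show "level \<beta> z = d" if "z \<in> M" for z using that by (simp add: M_def)
    qed (use fin \<open>L \<noteq> {}\<close> \<open>M \<noteq> {}\<close> \<open>c \<noteq> d\<close> 2 in auto)
  next
    case 3
    show ?thesis unfolding C(2)
    proof (rule third_line_case[where L = M and M = L and \<beta> = \<beta> and c = d and d = c])
      show "card N \<le> 3" if "N \<subseteq> insert b (M \<union> L) + insert b (M \<union> L)"
        "N \<inter> ((M \<union> L) + (M \<union> L)) = {}" for N
        using new that unfolding C(2) by blast
      show "inj_on Re (insert b (M \<union> L))" using assms(2) unfolding C(2) .
      show "card ((M \<union> L) + (M \<union> L)) + 3 \<le> 3 * card (M \<union> L)" using small unfolding C(2) .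
      show "3 \<le> card (M \<union> L)" using card3 unfolding C(2) .
      show "level \<beta> z = c" if "z \<in> L" for z using that by (simp add: L_def)
      show "level \<beta> z = d" if "z \<in> M" for z using that by (simp add: M_def)
    qed (use fin \<open>L \<noteq> {}\<close> \<open>M \<noteq> {}\<close> \<open>c \<noteq> d\<close> 3 in auto)
  next
    case 4
    have "b + z \<notin> C + C" if "z \<in> C" for z
    proof
      assume "b + z \<in> C + C"
      then obtain x y where xy: "x \<in> C" "y \<in> C" "b + z = x + y" by (rule set_plus_elim) auto
      have "level \<beta> b + level \<beta> z = level \<beta> x + level \<beta> y"
        using arg_cong[OF xy(3), of "level \<beta>"] by simp
      then show False using cd[OF xy(1)] cd[OF xy(2)] cd[OF that] 4 by auto
    qed
    then have "(+) b ` insert b C \<inter> (C + C) = {}" using assms(5) by blast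
    moreover have "(+) b ` insert b C \<subseteq> insert b C + insert b C"
      by (intro image_subsetI set_plus_intro) auto
    ultimately have "card ((+) b ` insert b C) \<le> 3" using new by blast
    moreover have "card ((+) b ` insert b C) = card (insert b C)" by (rule card_image) (auto simp: inj_on_def)
    moreover have "b \<notin> C" using 4 cd by blast
    ultimately show ?thesis using card3 assms(1) by simp
  qed
qed

text \<open>The equality case of Freiman's lemma. Deleting the rightmost point loses at least three
  sums, so a non-collinear rest is again extremal; Freiman's bound for the rest shows that at most
  three are lost, which restricts the deleted point.\<close>

lemma two_lines_or_triangle:
  assumes "finite B" "inj_on Re B" "\<not> collinear B" "card (B + B) + 3 \<le> 3 * card B"
  shows "two_lines B \<or> triangle B"
  using assms
proof (induction B rule: finite_psubset_induct)
  case (psubset B)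
  obtain b N where bN: "b \<in> B" "N \<subseteq> B + B" "N \<inter> ((B - {b}) + (B - {b})) = {}" "card N = 3"
    and max: "\<And>z. z \<in> B - {b} \<Longrightarrow> Re z < Re b"
    using three_new_sums[OF psubset.hyps(1) psubset.prems(1,2)] by metis
  define C where "C = B - {b}"
  have B: "B = insert b C" using bN(1) by (auto simp: C_def)
  have card: "card B = Suc (card C)" using bN(1) psubset.hyps unfolding C_def by (metis card.remove)
  have inj: "inj_on Re C" and fin: "finite C"
    using psubset.prems(1) psubset.hyps by (auto simp: C_def inj_on_diff)
  show ?case
  proof (cases "collinear C")
    case True
    then show ?thesis unfolding B collinear_def two_lines_def by blast
  next
    case False
    have drop: "card (C + C) + card N' \<le> card (B + B)" if "N' \<subseteq> B + B" "N' \<inter> (C + C) = {}" for N'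
      using that set_plus_mono2[of C B C B] psubset.hyps
      by (intro card_add_le_card finite_set_plus) (auto simp: C_def)
    have small: "card (C + C) + 3 \<le> 3 * card C"
      using drop[OF bN(2)] bN(3,4) psubset.prems(3) card unfolding C_def by linarith
    have new: "card N' \<le> 3" if "N' \<subseteq> insert b C + insert b C" "N' \<inter> (C + C) = {}" for N'
      using drop[OF that[folded B]] card_sumset_if_not_collinear[OF fin inj False]
        psubset.prems(3) card by linarith
    have "b \<notin> C" "C \<subset> B" using bN(1) by (auto simp: C_def)
    have "b + b \<notin> C + C"
    proof
      assume "b + b \<in> C + C"
      then obtain x y where xy: "x \<in> C" "y \<in> C" "b + b = x + y" by (rule set_plus_elim) auto
      then have "Re b + Re b = Re x + Re y" by (metis plus_complex.simps(1))
      then show False using max[of x] max[of y] xy(1,2) unfolding C_def by simp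
    qed
    from psubset.IH[OF \<open>C \<subset> B\<close> inj False small] show ?thesis
    proof
      assume "two_lines C"
      then show ?thesis
        using two_lines_extend[OF fin psubset.prems(1)[unfolded B] False _ \<open>b + b \<notin> C + C\<close> small new]
        unfolding B by blast
    next
      assume "triangle C"
      then show ?thesis
        using triangle_not_extendable[OF _ False inj \<open>b \<notin> C\<close> new] unfolding triangle_def by blast
    qed
  qed
qed

section \<open>Logarithms and valuations\<close>

text \<open>The type \<open>complex\<close> serves as the plane. The logarithm makes
  \<open>Re\<close> injective on positive integers, as the planar lemmas require.\<close>

definition log_val :: "nat \<Rightarrow> nat \<Rightarrow> complex" where
  "log_val p n = Complex (ln (real n)) (real (multiplicity p n))"

lemma log_val_mult:
  assumes "prime p" "0 < x" "0 < y"
  shows "log_val p (x * y) = log_val p x + log_val p y"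
  using assms by (simp add: log_val_def complex_eq_iff ln_mult prime_elem_multiplicity_mult_distrib)

lemma inj_on_ln: "0 \<notin> A \<Longrightarrow> inj_on (\<lambda>n::nat. ln (real n)) A"
  by (rule inj_onI) (metis gr0I ln_inj_iff of_nat_0_less_iff of_nat_eq_iff)

lemma inj_on_log_val: "0 \<notin> A \<Longrightarrow> inj_on (log_val p) A"
  using inj_on_ln[of A] by (auto simp: inj_on_def log_val_def)

lemma inj_on_Re_log_val: "0 \<notin> A \<Longrightarrow> inj_on Re (log_val p ` A)"
  using inj_on_ln[of A] by (auto simp: inj_on_def log_val_def)

lemma card_log_val: "0 \<notin> A \<Longrightarrow> card (log_val p ` A) = card A"
  by (simp add: card_image inj_on_log_val)

lemma card_prodset_log_val:
  assumes "prime p" "0 \<notin> A"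
  shows "card (log_val p ` A + log_val p ` A) = card (A * A)"
proof -
  have "log_val p ` (A * A) = log_val p ` A + log_val p ` A"
  proof
    show "log_val p ` (A * A) \<subseteq> log_val p ` A + log_val p ` A"
    proof
      fix z assume "z \<in> log_val p ` (A * A)"
      then obtain x y where xy: "x \<in> A" "y \<in> A" "z = log_val p (x * y)"
        by (auto elim!: set_times_elim)
      moreover have "0 < x" "0 < y" using xy assms(2) by (auto intro: gr0I)
      ultimately show "z \<in> log_val p ` A + log_val p ` A" using assms(1) by (auto simp: log_val_mult)
    qed
    show "log_val p ` A + log_val p ` A \<subseteq> log_val p ` (A * A)"
    proof
      fix z assume "z \<in> log_val p ` A + log_val p ` A"
      then obtain x y where xy: "x \<in> A" "y \<in> A" "z = log_val p x + log_val p y"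
        by (auto elim!: set_plus_elim)
      moreover have "0 < x" "0 < y" using xy assms(2) by (auto intro: gr0I)
      ultimately have "z = log_val p (x * y)" using assms(1) by (simp add: log_val_mult)
      then show "z \<in> log_val p ` (A * A)" using xy by auto
    qed
  qed
  moreover have "0 \<notin> A * A" using assms(2) by (auto elim!: set_times_elim)
  ultimately show ?thesis using card_log_val by metis
qed

section \<open>Sums and divisibility\<close>

text \<open>\<open>L\<close> will be the layer of lowest valuation \<open>m\<close>, with
  \<open>q = p ^ Suc m\<close>. A sum with exactly one summand in \<open>L\<close> is not divisible
  by \<open>q\<close>, unlike the sums of the rest. An extreme element \<open>e\<close> of
  \<open>A\<close> adds \<open>e + e\<close>, which equals no other sum.\<close>

lemma card_sumset_peel:
  fixes A :: "nat set"
  assumes "finite A" "L \<subseteq> A" "\<And>x. x \<in> L \<Longrightarrow> \<not> q dvd x" "\<And>x. x \<in> A - L \<Longrightarrow> q dvd x"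
  shows "card ((A - L) + (A - L)) + card (L + (A - L)) \<le> card (A + A)"
    and "e \<in> L \<Longrightarrow> (\<forall>z\<in>A. e \<le> z) \<or> (\<forall>z\<in>A. z \<le> e) \<Longrightarrow>
      card ((A - L) + (A - L)) + card (L + (A - L)) + 1 \<le> card (A + A)"
proof -
  let ?C = "A - L"
  have fin: "finite (A + A)" "finite (?C + ?C)" "finite (L + ?C)"
    using assms(1,2) finite_subset by (auto intro!: finite_set_plus)
  have "(?C + ?C) \<inter> (L + ?C) = {}"
  proof (rule ccontr)
    assume "(?C + ?C) \<inter> (L + ?C) \<noteq> {}"
    then obtain s where s: "s \<in> ?C + ?C" "s \<in> L + ?C" by blast
    have "q dvd s" using s(1) assms(4) by (auto elim!: set_plus_elim)
    moreover obtain x y where "x \<in> L" "y \<in> ?C" "s = x + y" using s(2) by (auto elim!: set_plus_elim)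
    ultimately show False using assms(3)[of x] assms(4)[of y] by (simp add: dvd_add_left_iff)
  qed
  then have eq: "card ((?C + ?C) \<union> (L + ?C)) = card (?C + ?C) + card (L + ?C)"
    using fin by (intro card_Un_disjoint) auto
  have sub: "(?C + ?C) \<union> (L + ?C) \<subseteq> A + A"
    using set_plus_mono2[of ?C A ?C A] set_plus_mono2[of L A ?C A] assms(2) by blast
  show "card (?C + ?C) + card (L + ?C) \<le> card (A + A)"
    using card_mono[OF fin(1) sub] eq by simp
  assume e: "e \<in> L" "(\<forall>z\<in>A. e \<le> z) \<or> (\<forall>z\<in>A. z \<le> e)"
  have "e + e \<noteq> x + y" if "x \<in> A" "y \<in> ?C" for x y
  proof -
    have "e \<le> x \<and> e \<le> y \<or> x \<le> e \<and> y \<le> e" using e(2) that by blast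
    moreover have "y \<noteq> e" using that e by auto
    ultimately show ?thesis by linarith
  qed
  then have "(?C + ?C \<union> (L + ?C)) \<inter> {e + e} = {}"
    using assms(2) by (fastforce elim!: set_plus_elim)
  moreover have "{e + e} \<subseteq> A + A" using e(1) assms(2) by (intro insert_subsetI set_plus_intro) auto
  ultimately have "card ((?C + ?C) \<union> (L + ?C)) + card {e + e} \<le> card (A + A)"
    using fin sub by (intro card_add_le_card) auto
  then show "card (?C + ?C) + card (L + ?C) + 1 \<le> card (A + A)" using eq by simp
qed

text \<open>If the conclusion fails, then \<open>C\<close> is an arithmetic progression of difference \<open>|x - y|\<close>; but in a progression
  of at least six terms the lowest valuation occurs at least three times.\<close>

lemma card_pair_sumset_ge:
  fixes C :: "nat set"
  assumes "finite C" "6 \<le> card C" "x \<noteq> y"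
    and W: "{z \<in> C. \<not> q dvd z} \<noteq> {}" "card {z \<in> C. \<not> q dvd z} \<le> 2"
  shows "card C + 2 \<le> card ({x, y} + C)"
  using assms(3)
proof (induction x y rule: linorder_wlog)
  case (sym x y)
  then show ?case by (simp add: insert_commute)
next
  case (le x y)
  define D where "D = y - x"
  have D: "y = x + D" "0 < D" using le by (auto simp: D_def)
  \<comment> \<open>Since \<open>y + z = x + (z + D)\<close>, the sum \<open>y + z\<close> lies
    outside \<open>x + C\<close> exactly if \<open>z + D\<close> is not in \<open>C\<close>; so
    \<open>card U\<close> sums are gained.\<close>
  define U where "U = {z \<in> C. z + D \<notin> C}"
  define W where "W = {z \<in> C. \<not> q dvd z}"
  define H where "H = {z \<in> C. q dvd z}"
  have fin: "finite U" "finite W" "finite H" using assms(1) by (auto simp: U_def W_def H_def)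
  have "C = W \<union> H" "W \<inter> H = {}" by (auto simp: W_def H_def)
  then have "card C = card W + card H" using fin card_Un_disjoint by metis
  then have "4 \<le> card H" using assms(2) W(2) by (simp add: W_def)
  have "2 \<le> card U"
  \<comment> \<open>If \<open>q\<close> divides \<open>D\<close>, shifting by \<open>D\<close>
    respects divisibility by \<open>q\<close>, so the maxima of \<open>W\<close> and
    \<open>H\<close> are both in \<open>U\<close>. Otherwise the shift maps \<open>H - U\<close>
    into \<open>W\<close>, so at most two of the at least four elements of \<open>H\<close> avoid
    \<open>U\<close>.\<close>
  proof (cases "q dvd D")
    case True
    have top: "Max T \<in> U" if "T = W \<or> T = H" "T \<noteq> {}" for T
    proof -
      have "finite T" using that fin by auto
      then have "Max T \<in> T" using that by simp
      moreover have "Max T + D \<notin> T" using \<open>finite T\<close> D(2) by (metis Max_ge add_le_same_cancel1 not_less)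
      ultimately show ?thesis using that(1) True by (auto simp: U_def W_def H_def dvd_add_left_iff)
    qed
    have "W \<noteq> {}" "H \<noteq> {}" using W(1) \<open>4 \<le> card H\<close> by (auto simp: W_def)
    then have "{Max W, Max H} \<subseteq> U" "Max W \<in> W" "Max H \<in> H" using top fin by auto
    moreover from this have "Max W \<noteq> Max H" by (auto simp: W_def H_def)
    ultimately show ?thesis using card_mono[of U "{Max W, Max H}"] fin by simp
  next
    case False
    have "(\<lambda>z. z + D) ` (H - U) \<subseteq> W"
      using False by (auto simp: H_def U_def W_def dvd_add_right_iff)
    then have "card (H - U) \<le> card W"
      using fin by (metis card_image card_mono inj_on_add')
    then have "card (H - U) \<le> 2" using W(2) by (simp add: W_def)
    moreover have "card H \<le> card (H - U) + card U" using diff_card_le_card_Diff[of U H] fin by linarith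
    ultimately show ?thesis using \<open>4 \<le> card H\<close> by linarith
  qed
  have "card ((+) x ` C) + card ((+) y ` U) \<le> card ({x, y} + C)"
  proof (rule card_add_le_card)
    show "finite ({x, y} + C)" using assms(1) by (intro finite_set_plus) auto
    show "(+) x ` C \<subseteq> {x, y} + C" "(+) y ` U \<subseteq> {x, y} + C"
        by (auto simp: U_def)
    show "(+) x ` C \<inter> (+) y ` U = {}" by (auto simp: D(1) U_def ac_simps)
  qed
  moreover have "card ((+) x ` C) = card C" "card ((+) y ` U) = card U"
    by (auto intro: card_image)
  ultimately show ?case using \<open>2 \<le> card U\<close> by linarith
qed

section \<open>Peeling off the layers of a valuation\<close>

text \<open>\<open>T\<close> will hold one level for collinear points and two for points on two
  parallel lines. Finiteness and positivity are included so that one property passes to the sets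
  left by peeling.\<close>

definition on_levels :: "nat \<Rightarrow> real \<Rightarrow> real set \<Rightarrow> nat set \<Rightarrow> bool" where
  "on_levels p \<beta> T A \<longleftrightarrow> finite A \<and> 0 \<notin> A \<and> (\<forall>x\<in>A. level \<beta> (log_val p x) \<in> T)"

lemma on_levels_subset: "on_levels p \<beta> T A \<Longrightarrow> C \<subseteq> A \<Longrightarrow> on_levels p \<beta> T C"
  unfolding on_levels_def using finite_subset by blast

text \<open>As the slope is nonzero, the valuation determines the number on each level, so the layer
  meets a level at most once. If it meets every level, it contains the least element of each level
  for \<open>\<beta> > 0\<close> and the greatest for \<open>\<beta> < 0\<close>, hence an extreme
  element of \<open>A\<close>.\<close>

lemma lowest_layer:
  assumes "prime p" "\<beta> \<noteq> 0" "finite T" "on_levels p \<beta> T A" "A \<noteq> {}"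
  obtains L q where "L \<subseteq> A" "L \<noteq> {}" "card L \<le> card T"
    "\<And>x. x \<in> L \<Longrightarrow> \<not> q dvd x" "\<And>x. x \<in> A - L \<Longrightarrow> q dvd x"
    "card L = card T \<Longrightarrow> \<exists>e\<in>L. (\<forall>z\<in>A. e \<le> z) \<or> (\<forall>z\<in>A. z \<le> e)"
proof -
  let ?v = "multiplicity p" and ?h = "\<lambda>x. level \<beta> (log_val p x)"
  have fin: "finite A" and pos: "\<And>x. x \<in> A \<Longrightarrow> 0 < x" and T: "?h ` A \<subseteq> T"
    using assms(4) by (auto simp: on_levels_def intro!: gr0I)
  define m where "m = Min (?v ` A)"
  define L where "L = {x \<in> A. ?v x = m}"
  have m: "m \<le> ?v x" if "x \<in> A" for x using that fin by (simp add: m_def)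
  have "m \<in> ?v ` A" unfolding m_def using fin assms(5) by (intro Min_in) auto
  then have "L \<noteq> {}" by (auto simp: L_def)
  have "L \<subseteq> A" "finite L" using fin by (auto simp: L_def)
  have cmp: "real (?v y) - real (?v x) = \<beta> * (ln (real y) - ln (real x))"
    if "?h x = ?h y" for x y
    using that by (simp add: level_def log_val_def algebra_simps)
  have inj: "inj_on ?h L"
  proof (rule inj_onI)
    fix x y assume "x \<in> L" "y \<in> L" "?h x = ?h y"
    moreover from this have "0 < x" "0 < y" "?v x = ?v y" using pos by (auto simp: L_def)
    ultimately show "x = y" using cmp[of x y] assms(2) by simp
  qed
  then have card: "card (?h ` L) = card L" by (rule card_image)
  have "?h ` L \<subseteq> T" using T \<open>L \<subseteq> A\<close> by blast
  show ?thesis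
  proof (rule that[of L "p ^ Suc m"])
    show "card L \<le> card T" using card card_mono[OF assms(3) \<open>?h ` L \<subseteq> T\<close>] by simp
    have "\<not> is_unit p" using assms(1) not_prime_unit by blast
    then have iff: "p ^ Suc m dvd x \<longleftrightarrow> Suc m \<le> ?v x" if "x \<in> A" for x
      using pos[OF that] by (intro power_dvd_iff_le_multiplicity) auto
    show "\<not> p ^ Suc m dvd x" if "x \<in> L" for x
      using iff[of x] that by (simp add: L_def)
    show "p ^ Suc m dvd x" if "x \<in> A - L" for x
      using iff[of x] m[of x] that by (auto simp: L_def)
    assume "card L = card T"
    then have hL: "?h ` L = T" using card card_subset_eq[OF assms(3) \<open>?h ` L \<subseteq> T\<close>] by simp
    have ex: "\<exists>x\<in>L. 0 \<le> \<beta> * (ln (real z) - ln (real x))" if "z \<in> A" for z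
    proof -
      have "?h z \<in> ?h ` L" using T hL that by blast
      then obtain x where x: "x \<in> L" "?h x = ?h z" by auto
      then have "?v x \<le> ?v z" using m[OF that] by (simp add: L_def)
      then show ?thesis using cmp[OF x(2)] x(1) by force
    qed
    show "\<exists>e\<in>L. (\<forall>z\<in>A. e \<le> z) \<or> (\<forall>z\<in>A. z \<le> e)"
    proof (cases "0 < \<beta>")
      case True
      have "Min L \<le> z" if z: "z \<in> A" for z
      proof -
        obtain x where x: "x \<in> L" "0 \<le> \<beta> * (ln (real z) - ln (real x))" using ex[OF z] by blast
        then have "ln (real x) \<le> ln (real z)" using True by (simp add: zero_le_mult_iff)
        then have "x \<le> z" using pos[OF z] pos x(1) \<open>L \<subseteq> A\<close> by (subst (asm) ln_le_cancel_iff) auto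
        then show ?thesis using \<open>finite L\<close> x(1) Min_le order_trans by blast
      qed
      then show ?thesis using \<open>finite L\<close> \<open>L \<noteq> {}\<close> Min_in by blast
    next
      case False
      have "z \<le> Max L" if z: "z \<in> A" for z
      proof -
        obtain x where x: "x \<in> L" "0 \<le> \<beta> * (ln (real z) - ln (real x))" using ex[OF z] by blast
        then have "ln (real z) \<le> ln (real x)" using False assms(2) by (simp add: zero_le_mult_iff)
        then have "z \<le> x" using pos[OF z] pos x(1) \<open>L \<subseteq> A\<close> by (subst (asm) ln_le_cancel_iff) auto
        then show ?thesis using \<open>finite L\<close> x(1) Max_ge order_trans by blast
      qed
      then show ?thesis using \<open>finite L\<close> \<open>L \<noteq> {}\<close> Max_in by blast
    qed
  qed (use \<open>L \<subseteq> A\<close> \<open>L \<noteq> {}\<close> in auto)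
qed

lemma card_singleton_sumset: "card ({x} + C) = card C" for x :: nat
proof -
  have "{x} + C = (+) x ` C" by (auto simp: set_plus_def)
  then show ?thesis by (simp add: card_image)
qed

text \<open>Every layer is a single element, extreme in the current set. Taken from
  \<open>n + 1\<close> elements it costs \<open>n + 1\<close> sums, its double included; the
  triangular total is doubled to avoid division.\<close>

lemma card_sumset_one_level:
  assumes "prime p" "\<beta> \<noteq> 0" "on_levels p \<beta> {c} A"
  shows "card A * (card A + 1) \<le> 2 * card (A + A)"
  using assms(3)
proof (induction "card A" arbitrary: A)
  case 0
  then show ?case by simp
next
  case (Suc n)
  then have "A \<noteq> {}" and fin: "finite A" by (auto simp: on_levels_def)
  obtain L q where L: "L \<subseteq> A" "L \<noteq> {}" "card L \<le> card {c}"
    "\<And>x. x \<in> L \<Longrightarrow> \<not> q dvd x" "\<And>x. x \<in> A - L \<Longrightarrow> q dvd x"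
    "card L = card {c} \<Longrightarrow> \<exists>e\<in>L. (\<forall>z\<in>A. e \<le> z) \<or> (\<forall>z\<in>A. z \<le> e)"
    by (rule lowest_layer[OF assms(1,2) _ Suc.prems \<open>A \<noteq> {}\<close>]) (simp, rule that)
  have "finite L" using L(1) fin finite_subset by blast
  then have "card L = 1" using L(2,3) by (simp add: card_gt_0_iff Suc_leI order_antisym)
  then obtain x where x: "L = {x}" by (metis card_1_singletonE)
  obtain e where "e \<in> L" "(\<forall>z\<in>A. e \<le> z) \<or> (\<forall>z\<in>A. z \<le> e)" using L(6)[unfolded \<open>card L = 1\<close>] by auto
  then have peel: "card ((A - L) + (A - L)) + card (L + (A - L)) + 1 \<le> card (A + A)"
    using card_sumset_peel(2)[OF fin L(1,4,5)] by blast
  have n: "card (A - L) = n" using Suc.hyps(2) L(1) x fin by simp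
  have "card (L + (A - L)) = n" unfolding x using card_singleton_sumset n x by simp
  then have "2 * card ((A - L) + (A - L)) + 2 * (n + 1) \<le> 2 * card (A + A)" using peel by simp
  moreover have "n * (n + 1) \<le> 2 * card ((A - L) + (A - L))"
    using Suc.hyps(1)[of "A - L"] n on_levels_subset[OF Suc.prems, of "A - L"] by auto
  moreover have "card A * (card A + 1) = n * (n + 1) + 2 * (n + 1)"
    unfolding Suc.hyps(2)[symmetric] by (simp add: algebra_simps)
  ultimately show ?case by simp
qed

text \<open>A single element has \<open>card A - 1\<close> sums with the rest. A layer of two meets
  both levels, so besides at least \<open>card A - 1\<close> sums with the rest it yields the double
  of an extreme element.\<close>

lemma peel_two_levels:
  assumes "prime p" "\<beta> \<noteq> 0" "on_levels p \<beta> {c, d} A" "3 \<le> card A"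
  shows "(\<exists>x\<in>A. card ((A - {x}) + (A - {x})) + card A \<le> card (A + A) + 1) \<or>
    (\<exists>x\<in>A. \<exists>y\<in>A. x \<noteq> y \<and> card ((A - {x, y}) + (A - {x, y})) + card A \<le> card (A + A) \<and>
      (8 \<le> card A \<longrightarrow> card ((A - {x, y}) + (A - {x, y})) + card A + 1 \<le> card (A + A)))"
proof -
  have "A \<noteq> {}" and fin: "finite A" using assms by (auto simp: on_levels_def)
  have cd: "card {c, d} \<le> 2" by (simp add: card_insert_if)
  obtain L q where L: "L \<subseteq> A" "L \<noteq> {}" "card L \<le> card {c, d}"
    "\<And>x. x \<in> L \<Longrightarrow> \<not> q dvd x" "\<And>x. x \<in> A - L \<Longrightarrow> q dvd x"
    "card L = card {c, d} \<Longrightarrow> \<exists>e\<in>L. (\<forall>z\<in>A. e \<le> z) \<or> (\<forall>z\<in>A. z \<le> e)"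
    by (rule lowest_layer[OF assms(1,2) _ assms(3) \<open>A \<noteq> {}\<close>]) (simp, rule that)
  have "finite L" using L(1) fin finite_subset by blast
  then have "card L \<noteq> 0" using L(2) by simp
  then consider "card L = 1" | "card L = 2" using L(3) cd by linarith
  then show ?thesis
  proof cases
    case 1
    then obtain x where x: "L = {x}" by (metis card_1_singletonE)
    have "card (A - L) = card A - 1" using L(1) x fin by simp
    then have "card (L + (A - L)) = card A - 1" unfolding x using card_singleton_sumset by simp
    then have "card ((A - L) + (A - L)) + card A \<le> card (A + A) + 1"
      using card_sumset_peel(1)[OF fin L(1,4,5)] by linarith
    then show ?thesis using x L(1) by blast
  next
    case 2
    then obtain x y where xy: "L = {x, y}" "x \<noteq> y" by (metis card_2_iff)
    define C where "C = A - L"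
    have C: "card C + 2 = card A" "finite C" "C \<noteq> {}"
    proof -
      have "card C = card A - 2" unfolding C_def using 2 L(1) \<open>finite L\<close> by (simp add: card_Diff_subset)
      then show "card C + 2 = card A" using assms(4) by simp
      then show "C \<noteq> {}" using assms(4) by auto
    qed (simp add: C_def fin)
    have "card L = card {c, d}" using L(3) 2 cd by linarith
    then obtain e where "e \<in> L" "(\<forall>z\<in>A. e \<le> z) \<or> (\<forall>z\<in>A. z \<le> e)" using L(6) by blast
    then have peel: "card (C + C) + card (L + C) + 1 \<le> card (A + A)"
      unfolding C_def using card_sumset_peel(2)[OF fin L(1,4,5)] by blast
    have "card L + card C \<le> card (L + C) + 1"
      using \<open>finite L\<close> L(2) C by (intro card_sumset_ge[of real]) auto
    then have "card (C + C) + card A \<le> card (A + A)" using peel 2 C(1) by linarith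
    moreover have "card (C + C) + card A + 1 \<le> card (A + A)" if "8 \<le> card A"
    proof -
      \<comment> \<open>Now \<open>C\<close> has at least six elements and its own lowest layer at
        most two, so the pair \<open>L\<close> has at least \<open>card C + 2\<close> sums with
        \<open>C\<close>.\<close>
      have lev: "on_levels p \<beta> {c, d} C" using on_levels_subset[OF assms(3)] by (simp add: C_def)
      obtain L' q' where L': "L' \<subseteq> C" "L' \<noteq> {}" "card L' \<le> card {c, d}"
        "\<And>x. x \<in> L' \<Longrightarrow> \<not> q' dvd x" "\<And>x. x \<in> C - L' \<Longrightarrow> q' dvd x"
        by (rule lowest_layer[OF assms(1,2) _ lev C(3)]) (simp, rule that)
      then have "{z \<in> C. \<not> q' dvd z} = L'" by blast
      then have "card C + 2 \<le> card (L + C)"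
        unfolding xy(1) using that C L'(2,3) cd xy(2) by (intro card_pair_sumset_ge[of _ _ _ q']) auto
      then show ?thesis using peel C(1) by linarith
    qed
    ultimately show ?thesis using xy L(1) unfolding C_def by blast
  qed
qed

text \<open>The bounds follow \<open>F k = min (F (k - 1) + k - 1) (F (k - 2) + k)\<close>, with one
  more in the second term for \<open>k \<ge> 8\<close>. From the trivial values 5 and 7 at three and
  four elements come 10, 13, 17, 22; without the extra sum the value at 8 would be 21. At 9 the
  bound 25 suffices.\<close>

lemma card_sumset_two_levels:
  assumes "prime p" "\<beta> \<noteq> 0" "on_levels p \<beta> {c, d} A"
  shows "card A = 8 \<Longrightarrow> 22 \<le> card (A + A)" "card A = 9 \<Longrightarrow> 25 \<le> card (A + A)"
proof -
  let ?P = "on_levels p \<beta> {c, d}"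
  have triv: "2 * card A \<le> card (A + A) + 1" if "?P A" "A \<noteq> {}" for A
    using card_sumset_ge[of real A A] that by (auto simp: on_levels_def)
  have step: "F \<le> card (A + A)"
    if "?P A" "card A = k" "3 \<le> k"
      and 1: "\<And>C. ?P C \<Longrightarrow> card C = k - 1 \<Longrightarrow> F + 1 \<le> card (C + C) + k"
      and 2: "\<And>C. ?P C \<Longrightarrow> card C = k - 2 \<Longrightarrow> F \<le> card (C + C) + k + (if 8 \<le> k then 1 else 0)"
    for A k F
  proof -
    have fin: "finite A" using that(1) by (simp add: on_levels_def)
    have "F + 1 \<le> card ((A - {x}) + (A - {x})) + k" if "x \<in> A" for x
      using 1[of "A - {x}"] on_levels_subset[OF \<open>?P A\<close>, of "A - {x}"] that fin \<open>card A = k\<close> by simp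
    moreover have "F \<le> card ((A - {x, y}) + (A - {x, y})) + k + (if 8 \<le> k then 1 else 0)"
      if "x \<in> A" "y \<in> A" "x \<noteq> y" for x y
    proof (rule 2)
      show "?P (A - {x, y})" using on_levels_subset[OF \<open>?P A\<close>, of "A - {x, y}"] by auto
      show "card (A - {x, y}) = k - 2" using that fin \<open>card A = k\<close> by (simp add: card_Diff_subset)
    qed
    ultimately show ?thesis
      using peel_two_levels[OF assms(1,2) \<open>?P A\<close>] \<open>card A = k\<close> \<open>3 \<le> k\<close> by (fastforce split: if_splits)
  qed
  have triv': "2 * k \<le> card (A + A) + 1" if "?P A" "card A = k" for A k
    using triv[OF that(1)] that(2) by (cases "A = {}") auto
  have 5: "10 \<le> card (A + A)" if "?P A" "card A = 5" for A
    by (rule step[OF that]) (use triv'[where k = 4] triv'[where k = 3] in force)+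
  have 6: "13 \<le> card (A + A)" if "?P A" "card A = 6" for A
    by (rule step[OF that]) (use 5 triv'[where k = 4] in force)+
  have 7: "17 \<le> card (A + A)" if "?P A" "card A = 7" for A
    by (rule step[OF that]) (use 6 5 in force)+
  have 8: "22 \<le> card (A + A)" if "?P A" "card A = 8" for A
    by (rule step[OF that]) (use 7 6 in force)+
  show "card A = 8 \<Longrightarrow> 22 \<le> card (A + A)" using 8 assms(3) by blast
  show "25 \<le> card (A + A)" if "card A = 9"
    by (rule step[OF assms(3) that]) (use 8 7 in force)+
qed

section \<open>Sums against products\<close>

lemma ex_two_distinct:
  assumes "finite A" "2 \<le> card A"
  obtains x y where "x \<in> A" "y \<in> A" "x \<noteq> y"
proof -
  have "\<not> card A \<le> Suc 0" using assms(2) by simp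
  then show ?thesis using that card_le_Suc0_iff_eq[OF assms(1)] by blast
qed

lemma ex_prime_multiplicity_neq:
  fixes x y :: nat
  assumes "x \<noteq> y" "0 < x" "0 < y"
  obtains p where "prime p" "multiplicity p x \<noteq> multiplicity p y"
  using multiplicity_eq_nat[OF assms(2,3)] assms(1) by blast

text \<open>Freiman's lemma puts the points on a line; its slope is nonzero because \<open>p\<close>
  is chosen to distinguish two elements of \<open>A\<close>.\<close>

lemma card_sumset_if_prodset_small:
  fixes A :: "nat set"
  assumes "finite A" "0 \<notin> A" "2 \<le> card A" "card (A * A) + 3 < 3 * card A"
  shows "card A * (card A + 1) \<le> 2 * card (A + A)"
proof -
  obtain x y where xy: "x \<in> A" "y \<in> A" "x \<noteq> y"
    using ex_two_distinct[OF assms(1,3)] by blast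
  then obtain p where p: "prime p" "multiplicity p x \<noteq> multiplicity p y"
    using ex_prime_multiplicity_neq assms(2) by (metis gr0I)
  have "collinear (log_val p ` A)"
    using card_sumset_if_not_collinear[of "log_val p ` A"] assms inj_on_Re_log_val card_log_val
      card_prodset_log_val[OF p(1) assms(2)] by fastforce
  then obtain \<beta> c where c: "\<And>z. z \<in> A \<Longrightarrow> level \<beta> (log_val p z) = c" unfolding collinear_def by auto
  have "\<beta> \<noteq> 0" using c[OF xy(1)] c[OF xy(2)] p(2) by (auto simp: level_def log_val_def)
  moreover have "on_levels p \<beta> {c} A" using c assms by (simp add: on_levels_def)
  ultimately show ?thesis using card_sumset_one_level p(1) by blast
qed

text \<open>A slope zero for every prime would mean that every valuation takes at most two values on \<open>A\<close>. The larger of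
  the two parts into which one valuation splits \<open>A\<close> is then not on a line for another prime, and \<open>AA\<close> becomes too large.\<close>

lemma ex_two_levels:
  fixes A :: "nat set"
  assumes "finite A" "0 \<notin> A" "7 \<le> card A" "card (A * A) + 3 \<le> 3 * card A"
  shows "\<exists>p \<beta> c d. prime p \<and> \<beta> \<noteq> 0 \<and> on_levels p \<beta> {c, d} A"
proof (rule ccontr)
  assume contr: "\<not> ?thesis"
  have two_values: "\<exists>c d. \<forall>x\<in>A. real (multiplicity p x) \<in> {c, d}" if p: "prime p" for p
  proof -
    let ?B = "log_val p ` A"
    have card: "card ?B = card A" "card (?B + ?B) = card (A * A)"
      using card_log_val card_prodset_log_val p assms by auto
    have "\<not> triangle ?B"
    proof
      assume "triangle ?B"
      then obtain a u w where "?B = {a, u, w, 2 * u - a, u + w - a, 2 * w - a}"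
        unfolding triangle_def by blast
      then have "?B = set [a, u, w, 2 * u - a, u + w - a, 2 * w - a]" by simp
      then have "card ?B \<le> 6" using card_length[of "[a, u, w, 2 * u - a, u + w - a, 2 * w - a]"] by simp
      then show False using card assms(3) by simp
    qed
    moreover have "two_lines ?B" if "collinear ?B"
      using that unfolding collinear_def two_lines_def by blast
    ultimately have "two_lines ?B"
      using two_lines_or_triangle[of ?B] assms card inj_on_Re_log_val by fastforce
    then obtain \<beta> c d where "on_levels p \<beta> {c, d} A"
      using assms unfolding two_lines_def on_levels_def by auto
    moreover from this have "\<beta> = 0" using contr p by blast
    ultimately show ?thesis by (auto simp: on_levels_def level_def log_val_def)
  qed
  have pos: "0 < x" if "x \<in> A" for x using that assms(2) by (auto intro: gr0I)
  have "2 \<le> card A" using assms(3) by simp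
  then obtain x y where xy: "x \<in> A" "y \<in> A" "x \<noteq> y"
    using ex_two_distinct[OF assms(1)] by blast
  then obtain p where p: "prime p" "multiplicity p x \<noteq> multiplicity p y"
    using ex_prime_multiplicity_neq pos by metis
  obtain c d where "\<forall>z\<in>A. real (multiplicity p z) \<in> {c, d}" using two_values[OF p(1)] by blast
  then have cd: "real (multiplicity p z) \<in> {c, d}" if "z \<in> A" for z using that by blast
  define S where "S e = {z \<in> A. real (multiplicity p z) = e}" for e
  have "c \<noteq> d" using cd[OF xy(1)] cd[OF xy(2)] p(2) by auto
  have "A = S c \<union> S d" "S c \<inter> S d = {}" using cd \<open>c \<noteq> d\<close> by (auto simp: S_def)
  have "S c \<noteq> {}" "S d \<noteq> {}"
    using cd[OF xy(1)] cd[OF xy(2)] xy p(2) unfolding S_def by force+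
  \<comment> \<open>The larger part has \<open>s \<ge> 4\<close> elements. Were it collinear for
    \<open>q\<close>, the slope would be nonzero and its valuations distinct, but only two occur. So
    it has at least \<open>3 * s - 3\<close> products, and the two lines for \<open>p\<close> give
    at least \<open>3 * card A + s - 5\<close> products of \<open>A\<close>, which is too
    many.\<close>
  have contra: False
    if "A = S c \<union> S d" "S c \<inter> S d = {}" "S c \<noteq> {}" "S d \<noteq> {}" "c \<noteq> d" "card (S d) \<le> card (S c)" for c d
  proof -
    have fin: "finite (S c)" "finite (S d)" and pos': "0 \<notin> S c" "0 \<notin> S d"
      using assms(1,2) by (auto simp: S_def)
    have card: "card A = card (S c) + card (S d)" using that fin card_Un_disjoint by metis
    then have "4 \<le> card (S c)" using that(6) assms(3) by linarith
    then have "2 \<le> card (S c)" by simp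
    then obtain x y where xy: "x \<in> S c" "y \<in> S c" "x \<noteq> y"
      using ex_two_distinct[OF fin(1)] by blast
    then have "0 < x" "0 < y" using pos by (auto simp: S_def)
    then obtain q where q: "prime q" "multiplicity q x \<noteq> multiplicity q y"
      using ex_prime_multiplicity_neq xy(3) by metis
    have "\<not> collinear (log_val q ` S c)"
    proof
      assume "collinear (log_val q ` S c)"
      then obtain \<beta> t where t: "\<And>z. z \<in> S c \<Longrightarrow> level \<beta> (log_val q z) = t"
        unfolding collinear_def by auto
      then have "\<beta> \<noteq> 0" using t[OF xy(1)] t[OF xy(2)] q(2) by (auto simp: level_def log_val_def)
      have "inj_on (\<lambda>z. real (multiplicity q z)) (S c)"
      proof (rule inj_onI)
        fix z w assume zw: "z \<in> S c" "w \<in> S c" "real (multiplicity q z) = real (multiplicity q w)"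
        then have "\<beta> * ln (real z) = \<beta> * ln (real w)"
          using t[OF zw(1)] t[OF zw(2)] unfolding level_def log_val_def complex.sel by linarith
        then have "ln (real z) = ln (real w)" using \<open>\<beta> \<noteq> 0\<close> by simp
        then show "z = w" using inj_onD[OF inj_on_ln[OF pos'(1)]] zw(1,2) by blast
      qed
      moreover obtain c' d' where "\<forall>z\<in>A. real (multiplicity q z) \<in> {c', d'}"
        using two_values[OF q(1)] by blast
      then have "(\<lambda>z. real (multiplicity q z)) ` S c \<subseteq> {c', d'}" unfolding S_def by blast
      ultimately have "card (S c) \<le> card {c', d'}" by (metis card_image card_mono finite.emptyI finite_insert)
      then show False using \<open>4 \<le> card (S c)\<close> by (cases "c' = d'") auto
    qed
    then have large: "3 * card (S c) \<le> card (S c * S c) + 3"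
      using card_sumset_if_not_collinear[of "log_val q ` S c"] fin inj_on_Re_log_val pos' card_log_val
        card_prodset_log_val[OF q(1)] by simp
    have lev: "level 0 z = e" if "z \<in> log_val p ` S e" for z e
      using that by (auto simp: S_def level_def log_val_def)
    have "card (log_val p ` S c + log_val p ` S c) + card (log_val p ` S c)
        + 3 * card (log_val p ` S d)
        \<le> card ((log_val p ` S c \<union> log_val p ` S d) + (log_val p ` S c \<union> log_val p ` S d)) + 2"
      using card_sumset_two_lines[of "log_val p ` S c" "log_val p ` S d" 0 c d] fin that(3-5) lev
        inj_on_Re_log_val[OF pos'(1)] inj_on_Re_log_val[OF pos'(2)] by simp
    then have "card (S c * S c) + card (S c) + 3 * card (S d) \<le> card (A * A) + 2"
      unfolding image_Un[symmetric] that(1)[symmetric] card_prodset_log_val[OF p(1) assms(2)]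
        card_prodset_log_val[OF p(1) pos'(1)] card_log_val[OF pos'(1)] card_log_val[OF pos'(2)] .
    then show False using large assms(4) card \<open>4 \<le> card (S c)\<close> by linarith
  qed
  show False
  proof (cases "card (S d) \<le> card (S c)")
    case True
    then show ?thesis using contra[of c d] \<open>A = S c \<union> S d\<close> \<open>S c \<inter> S d = {}\<close> \<open>S c \<noteq> {}\<close> \<open>S d \<noteq> {}\<close> \<open>c \<noteq> d\<close> by blast
  next
    case False
    then have "card (S c) \<le> card (S d)" by simp
    then show ?thesis using contra[of d c] \<open>A = S c \<union> S d\<close> \<open>S c \<inter> S d = {}\<close> \<open>S c \<noteq> {}\<close> \<open>S d \<noteq> {}\<close> \<open>c \<noteq> d\<close> by blast
  qed
qed

section \<open>Lower bounds for the larger of the two cardinalities\<close>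

lemma max_card_ge:
  fixes A :: "nat set"
  assumes "finite A" "0 \<notin> A" "2 \<le> card A"
  shows "3 * card A \<le> max (card (A + A)) (card (A * A)) + 3"
proof (rule ccontr)
  assume neg: "\<not> ?thesis"
  then have "card A * (card A + 1) \<le> 2 * card (A + A)"
    using card_sumset_if_prodset_small[OF assms] by simp
  then have "card A * (card A + 1) + 6 < 6 * card A" using neg by linarith
  \<comment> \<open>For \<open>k = card A\<close> the difference of the two sides is
    \<open>(k - 2) * (k - 3)\<close>.\<close>
  moreover have "6 * card A \<le> card A * (card A + 1) + 6"
  proof -
    obtain n where "card A = n + 2" using assms(3) by (metis add.commute le_Suc_ex)
    then show ?thesis by (cases n) (auto simp: algebra_simps)
  qed
  ultimately show False by simp
qed

lemma max_card_ge_8_9: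
  fixes A :: "nat set"
  assumes "finite A" "0 \<notin> A" "card A = 8 \<or> card A = 9"
  shows "3 * card A \<le> max (card (A + A)) (card (A * A)) + 2"
proof (rule ccontr)
  assume neg: "\<not> ?thesis"
  then have "7 \<le> card A" "card (A * A) + 3 \<le> 3 * card A" using assms(3) by auto
  then obtain p \<beta> c d where "prime p" "\<beta> \<noteq> 0" "on_levels p \<beta> {c, d} A"
    using ex_two_levels[OF assms(1,2)] by blast
  then have "3 * card A \<le> card (A + A) + 2" using card_sumset_two_levels[of p \<beta> c d A] assms(3) by auto
  then show False using neg by simp
qed

section \<open>The values of \<open>SP\<close> and sets that attain them\<close>

lemma SP_eqI:
  fixes A :: "nat set"
  assumes "finite A" "0 \<notin> A" "card A = k" "max (card (A + A)) (card (A * A)) = m"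
    and "\<And>A :: nat set. finite A \<Longrightarrow> 0 \<notin> A \<Longrightarrow> card A = k \<Longrightarrow> m \<le> max (card (A + A)) (card (A * A))"
  shows "SP k = m"
  unfolding SP_def
proof (rule Least_equality)
  show "\<exists>A :: nat set. 0 \<notin> A \<and> finite A \<and> card A = k \<and> m = max (card (A + A)) (card (A * A))"
    using assms(1-4) by (intro exI[of _ A]) simp
qed (use assms(5) in blast)

lemma insert_set_times: "insert a A * B = A * B \<union> (*) a ` B" "{} * B = {}"
  by (auto simp: set_times_def)

theorem theorem1p1:
  fixes k :: nat
  shows "(2 \<le> k \<and> k \<le> 7 \<longrightarrow> SP k = 3 * k - 3) \<and>
         (k = 8 \<or> k = 9 \<longrightarrow> SP k = 3 * k - 2)"
proof -
  have small: "SP k = 3 * k - 3"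
    if "finite A" "0 \<notin> A" "card A = k" "max (card (A + A)) (card (A * A)) = 3 * k - 3" "2 \<le> k"
    for A :: "nat set" and k
    using that max_card_ge by (intro SP_eqI[of A]) fastforce+
  have large: "SP k = 3 * k - 2"
    if "finite A" "0 \<notin> A" "card A = k" "max (card (A + A)) (card (A * A)) = 3 * k - 2" "k = 8 \<or> k = 9"
    for A :: "nat set" and k
    using that max_card_ge_8_9 by (intro SP_eqI[of A]) fastforce+
  note calc = insert_set_plus insert_set_times card_insert_if
  \<comment> \<open>For \<open>k\<close> from 3 to 7 the witnesses consist of the first
    \<open>m\<close> powers of 2 and 3 times the first \<open>n\<close> of them: two parallel lines
    with exactly \<open>(2 * m - 1) + (m + n - 1) + (2 * n - 1) = 3 * k - 3\<close> products. Then 9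
    and 16 are added in turn.\<close>
  have "SP 2 = 3 * 2 - 3" by (rule small[of "{1, 2}"]) (simp_all add: calc del: One_nat_def)
  moreover have "SP 3 = 3 * 3 - 3" by (rule small[of "{1, 2, 3}"]) (simp_all add: calc del: One_nat_def)
  moreover have "SP 4 = 3 * 4 - 3" by (rule small[of "{1, 2, 3, 4}"]) (simp_all add: calc del: One_nat_def)
  moreover have "SP 5 = 3 * 5 - 3" by (rule small[of "{1, 2, 3, 4, 6}"]) (simp_all add: calc del: One_nat_def)
  moreover have "SP 6 = 3 * 6 - 3" by (rule small[of "{1, 2, 3, 4, 6, 8}"]) (simp_all add: calc del: One_nat_def)
  moreover have "SP 7 = 3 * 7 - 3" by (rule small[of "{1, 2, 3, 4, 6, 8, 12}"]) (simp_all add: calc del: One_nat_def)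
  moreover have "SP 8 = 3 * 8 - 2" by (rule large[of "{1, 2, 3, 4, 6, 8, 9, 12}"]) (simp_all add: calc del: One_nat_def)
  moreover have "SP 9 = 3 * 9 - 2" by (rule large[of "{1, 2, 3, 4, 6, 8, 9, 12, 16}"]) (simp_all add: calc del: One_nat_def)
  moreover have "k = 2 \<or> k = 3 \<or> k = 4 \<or> k = 5 \<or> k = 6 \<or> k = 7" if "2 \<le> k" "k \<le> 7" using that by linarith
  ultimately show ?thesis by auto
qed

end
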